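(* For every integer $k\ge 3$, there exist infinitely many pairwise non-isomorphic $k$-graphs $(X,\mathscr{M})$ such that: 1. $(X,\mathscr{M})$ is asymmetric. 2. If $(X',\mathscr{M}')$ is a proper $k$-subgraph of $(X,\mathscr{M})$ with at least two vertices, then $(X',\mathscr{M}')$ is symmetric.
   Context: A $k$-graph (or $k$-uniform hypergraph) is a pair $(X,\mathscr{M})$ where $X$ is a finite set (the vertices) and $\mathscr{M}\subseteq\binom{X}{k}=\{A\subseteq X: |A|=k\}$ (the edges). An automorphism of $(X,\mathscr{M})$ is a bijection $\phi:X\to X$ such that, for every $A\subseteq X$ with $|A|=k$, $A\in\mathscr{M}$ if and only if $\phi(A)\in\mathscr{M}$. A $k$-graph is asymmetric if its only automorphism is the identity; otherwise it is symmetric. A $k$-subgraph of $(X,\mathscr{M})$ is a $k$-graph $(X',\mathscr{M}')$ with $X'\subseteq X$ and $\mathscr{M}'\subseteq\mathscr{M}$ (not necessarily induced); it is proper if $(X',\mathscr{M}')\ne(X,\mathscr{M})$. "Infinitely many" is understood up to isomorphism. *)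

theory Defs
  imports Main "HOL-Library.Ramsey"
begin

type_synonym 'a hgraph = "'a set \<times> 'a set set"

abbreviation verts :: "'a hgraph \<Rightarrow> 'a set" where
  "verts G \<equiv> fst G"

abbreviation edges :: "'a hgraph \<Rightarrow> 'a set set" where
  "edges G \<equiv> snd G"

definition kgraph :: "nat \<Rightarrow> 'a hgraph \<Rightarrow> bool" where
  "kgraph k G \<longleftrightarrow> finite (verts G) \<and> edges G \<subseteq> nsets (verts G) k"

definition isomorphism :: "nat \<Rightarrow> 'a hgraph \<Rightarrow> 'b hgraph \<Rightarrow> ('a \<Rightarrow> 'b) \<Rightarrow> bool" where
  "isomorphism k G H \<phi> \<longleftrightarrow>
     bij_betw \<phi> (verts G) (verts H) \<and>
     (\<forall>A \<in> nsets (verts G) k. A \<in> edges G \<longleftrightarrow> \<phi> ` A \<in> edges H)"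

definition isomorphic :: "nat \<Rightarrow> 'a hgraph \<Rightarrow> 'b hgraph \<Rightarrow> bool" where
  "isomorphic k G H \<longleftrightarrow> (\<exists>\<phi>. isomorphism k G H \<phi>)"

definition automorphism :: "nat \<Rightarrow> 'a hgraph \<Rightarrow> ('a \<Rightarrow> 'a) \<Rightarrow> bool" where
  "automorphism k G \<phi> \<longleftrightarrow> isomorphism k G G \<phi>"

(* Functions are total on the vertex type, so being the identity is only required on the
   vertices; values elsewhere are irrelevant. *)
definition asymmetric :: "nat \<Rightarrow> 'a hgraph \<Rightarrow> bool" where
  "asymmetric k G \<longleftrightarrow> (\<forall>\<phi>. automorphism k G \<phi> \<longrightarrow> (\<forall>x \<in> verts G. \<phi> x = x))"

abbreviation symmetric :: "nat \<Rightarrow> 'a hgraph \<Rightarrow> bool" where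
  "symmetric k G \<equiv> \<not> asymmetric k G"

definition ksubgraph :: "nat \<Rightarrow> 'a hgraph \<Rightarrow> 'a hgraph \<Rightarrow> bool" where
  "ksubgraph k H G \<longleftrightarrow> kgraph k H \<and> verts H \<subseteq> verts G \<and> edges H \<subseteq> edges G"

definition proper_ksubgraph :: "nat \<Rightarrow> 'a hgraph \<Rightarrow> 'a hgraph \<Rightarrow> bool" where
  "proper_ksubgraph k H G \<longleftrightarrow> ksubgraph k H G \<and> H \<noteq> G"

end

theory Submission
  imports Defs "HOL-Combinatorics.Transposition" "HOL-Library.Nat_Bijection"
begin

text \<open>
  Throughout, subgraphs have at least two vertices. Every asymmetric \<open>k\<close>-graph with at least two
  vertices contains one that is minimal among its asymmetric subgraphs. So it suffices to find, for every \<open>N\<close>, an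
  asymmetric \<open>k\<close>-graph in which every asymmetric subgraph has more than \<open>N\<close> vertices: minimal
  asymmetric \<open>k\<close>-graphs then occur in infinitely many orders.

  The obstruction to asymmetry of a subgraph is a pair of twins, two vertices that lie in the same
  edges: transposing them is an automorphism. Take \<open>3 p + 1\<close> edges \<open>E\<^sub>0, \<dots>, E\<^sub>3\<^sub>p\<close> arranged along a
  path, where consecutive edges share a link vertex lying in no other edge, and give every edge
  except \<open>E\<^sub>p\<close> a private vertex. When a subgraph keeps an inner edge \<open>E\<^sub>i\<close> with \<open>i \<noteq> p\<close> but loses a
  neighbour of it, the link towards that neighbour becomes a twin of the private vertex. Hence an
  asymmetric subgraph containing such an edge contains all edges strictly between \<open>E\<^sub>0\<close> and \<open>E\<^sub>p\<close>, or
  all edges strictly between \<open>E\<^sub>p\<close> and \<open>E\<^sub>3\<^sub>p\<close>; and a few more twins show that a subgraph without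
  such an edge is symmetric (\<open>path_traces_asymmetric_subgraph_large\<close>).

  The edges reach size \<open>k\<close> through \<open>k - 2\<close> hubs: the special edges \<open>E\<^sub>0\<close>, \<open>E\<^sub>p\<close>, \<open>E\<^sub>3\<^sub>p\<close>, which have
  only two link or private vertices, contain all hubs, and each other edge omits exactly one. Each
  hub is omitted by some edge, so no two vertices of the whole \<open>k\<close>-graph are twins, and an
  automorphism is determined by how it permutes the edges. Links are the vertices of degree two,
  so this permutation preserves the path; it is the identity or the reversal, and the reversal is
  excluded because \<open>E\<^sub>p\<close>, the only edge without a private vertex, is not in the middle
  (\<open>path_traces_rigid\<close>).

  A twin-free hypergraph can be described by the set of edge indices at each vertex, its trace. The
  construction is therefore carried out with the traces themselves as vertices, encoded as natural
  numbers.
\<close>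

section \<open>Twins and minimal asymmetric subgraphs\<close>

lemma twins_imp_symmetric:
  assumes "u \<in> verts H" "v \<in> verts H" "u \<noteq> v"
    and twins: "\<And>e. e \<in> edges H \<Longrightarrow> u \<in> e \<longleftrightarrow> v \<in> e"
  shows "symmetric k H"
proof
  assume asym: "asymmetric k H"
  let ?\<tau> = "transpose u v"
  have "A \<in> edges H \<longleftrightarrow> ?\<tau> ` A \<in> edges H" for A
  proof
    assume "A \<in> edges H"
    then show "?\<tau> ` A \<in> edges H" using twins by simp
  next
    assume im: "?\<tau> ` A \<in> edges H"
    then have "?\<tau> ` (?\<tau> ` A) = ?\<tau> ` A" using twins by simp
    then show "A \<in> edges H" using im by (simp add: image_comp)
  qed
  moreover have "bij_betw ?\<tau> (verts H) (verts H)"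
    using assms(1,2) by simp
  ultimately have "automorphism k H ?\<tau>"
    by (simp add: automorphism_def isomorphism_def)
  then have "?\<tau> u = u"
    using asym assms(1) unfolding asymmetric_def by blast
  then show False using assms(3) by simp
qed

lemma edgeless_imp_symmetric:
  assumes "edges H = {}" "card (verts H) \<ge> 2"
  shows "symmetric k H"
proof -
  have "finite (verts H)" using assms(2) by (intro card_ge_0_finite) simp
  moreover have "\<not> card (verts H) \<le> Suc 0" using assms(2) by simp
  ultimately obtain u v where "u \<in> verts H" "v \<in> verts H" "u \<noteq> v"
    using card_le_Suc0_iff_eq by blast
  then show ?thesis by (rule twins_imp_symmetric) (simp add: assms(1))
qed

definition strongly_minimal_asymmetric :: "nat \<Rightarrow> 'a hgraph \<Rightarrow> bool" where
  "strongly_minimal_asymmetric k G \<longleftrightarrow> kgraph k G \<and> asymmetric k G \<and>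
     (\<forall>H. proper_ksubgraph k H G \<and> card (verts H) \<ge> 2 \<longrightarrow> symmetric k H)"

lemma finite_edges: "kgraph k G \<Longrightarrow> finite (edges G)"
  unfolding kgraph_def by (meson finite_imp_finite_nsets finite_subset)

lemma ksubgraph_trans: "ksubgraph k K H \<Longrightarrow> ksubgraph k H G \<Longrightarrow> ksubgraph k K G"
  unfolding ksubgraph_def by blast

lemma proper_ksubgraph_size_less:
  assumes "proper_ksubgraph k H G" "kgraph k G"
  shows "card (verts H) + card (edges H) < card (verts G) + card (edges G)"
proof -
  have fin: "finite (verts G)" "finite (edges G)"
    using finite_edges[OF assms(2)] assms(2) by (simp_all add: kgraph_def)
  have sub: "verts H \<subseteq> verts G" "edges H \<subseteq> edges G" and "H \<noteq> G"
    using assms(1) unfolding proper_ksubgraph_def ksubgraph_def by blast+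
  then have "verts H \<noteq> verts G \<or> edges H \<noteq> edges G"
    by (simp only: prod_eq_iff de_Morgan_conj)
  then have "verts H \<subset> verts G \<or> edges H \<subset> edges G"
    using sub by blast
  then show ?thesis
  proof
    assume "verts H \<subset> verts G"
    then show ?thesis
      by (intro add_less_le_mono psubset_card_mono card_mono fin sub)
  next
    assume "edges H \<subset> edges G"
    then show ?thesis
      by (intro add_le_less_mono psubset_card_mono card_mono fin sub)
  qed
qed

text \<open>
  Descent on the total number of vertices and edges: as long as the current graph is not strongly
  minimal, it has a smaller asymmetric subgraph that still has two vertices.
\<close>

lemma strongly_minimal_asymmetric_ksubgraph_exists:
  assumes "kgraph k G" "asymmetric k G" "card (verts G) \<ge> 2"
  shows "\<exists>H. ksubgraph k H G \<and> card (verts H) \<ge> 2 \<and> strongly_minimal_asymmetric k H"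
  using assms
proof (induction "card (verts G) + card (edges G)" arbitrary: G rule: less_induct)
  case less
  show ?case
  proof (cases "strongly_minimal_asymmetric k G")
    case True
    moreover have "ksubgraph k G G" using less.prems(1) by (simp add: ksubgraph_def)
    ultimately show ?thesis using less.prems(3) by (intro exI[of _ G] conjI)
  next
    case False
    then obtain H where H: "proper_ksubgraph k H G" "card (verts H) \<ge> 2" "asymmetric k H"
      using less.prems unfolding strongly_minimal_asymmetric_def by blast
    then have sub: "ksubgraph k H G" and "kgraph k H"
      unfolding proper_ksubgraph_def ksubgraph_def by blast+
    then obtain K where "ksubgraph k K H" "card (verts K) \<ge> 2" "strongly_minimal_asymmetric k K"
      using less.hyps[OF proper_ksubgraph_size_less[OF H(1) less.prems(1)]] H by blast
    then show ?thesis using ksubgraph_trans[OF _ sub] by blast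
  qed
qed

text \<open>
  One representative of each order that occurs suffices, since isomorphic graphs have the same order.
\<close>

lemma infinite_family_of_unbounded_order:
  fixes P :: "nat hgraph \<Rightarrow> bool"
  assumes unbounded: "\<And>N. \<exists>G. P G \<and> card (verts G) > N"
  shows "\<exists>\<G>. infinite \<G> \<and> pairwise (\<lambda>G H. \<not> isomorphic k G H) \<G> \<and> (\<forall>G\<in>\<G>. P G)"
proof -
  define C where "C = (\<lambda>G. card (verts G)) ` {G. P G}"
  have "\<exists>c. c > N \<and> c \<in> C" for N
    using unbounded[of N] unfolding C_def by blast
  then have "infinite C" by (simp add: infinite_nat_iff_unbounded)
  define rep where "rep c = (SOME G. P G \<and> card (verts G) = c)" for c
  have rep: "P (rep c) \<and> card (verts (rep c)) = c" if "c \<in> C" for c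
    unfolding rep_def by (rule someI_ex) (use that in \<open>auto simp: C_def\<close>)
  have "inj_on rep C" by (metis inj_onI rep)
  then have "infinite (rep ` C)" using \<open>infinite C\<close> finite_imageD by blast
  moreover have "pairwise (\<lambda>G H. \<not> isomorphic k G H) (rep ` C)"
  proof (rule pairwiseI)
    fix G H assume "G \<in> rep ` C" "H \<in> rep ` C" "G \<noteq> H"
    then have "card (verts G) \<noteq> card (verts H)" using rep by auto
    then show "\<not> isomorphic k G H"
      using bij_betw_same_card unfolding isomorphic_def isomorphism_def by blast
  qed
  ultimately show ?thesis using rep by blast
qed

section \<open>Hypergraphs given by the traces of their vertices\<close>

definition star :: "nat set set \<Rightarrow> nat \<Rightarrow> nat set" where
  "star V i = set_encode ` {v \<in> V. i \<in> v}"

definition trace_hypergraph :: "nat set set \<Rightarrow> nat set \<Rightarrow> nat hgraph" where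
  "trace_hypergraph V S = (set_encode ` V, star V ` S)"

lemma set_encode_mem_star_iff:
  assumes "finite S" "V \<subseteq> Pow S" "v \<in> V"
  shows "set_encode v \<in> star V i \<longleftrightarrow> i \<in> v"
proof -
  have "w = v" if "w \<in> V" "set_encode w = set_encode v" for w
    using that assms by (metis PowD set_encode_inverse subset_iff finite_subset)
  then show ?thesis using assms(3) by (auto simp: star_def)
qed

lemma inj_on_set_encode_Pow:
  assumes "finite S" "V \<subseteq> Pow S"
  shows "inj_on set_encode V"
  using assms by (metis PowD finite_subset inj_onI set_encode_inverse subset_iff)

lemma trace_hypergraph_kgraph:
  assumes "finite S" "V \<subseteq> Pow S" "\<And>i. i \<in> S \<Longrightarrow> card {v \<in> V. i \<in> v} = k"
  shows "kgraph k (trace_hypergraph V S)"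
proof -
  have fin: "finite V" using assms(1,2) finite_subset by blast
  have "star V i \<in> nsets (set_encode ` V) k" if "i \<in> S" for i
  proof -
    have "card (star V i) = k"
      unfolding star_def
      by (subst card_image)
        (auto intro: inj_on_subset[OF inj_on_set_encode_Pow[OF assms(1,2)]] simp: assms(3) that)
    then show ?thesis using fin by (auto simp: nsets_def star_def)
  qed
  then show ?thesis using fin by (auto simp: kgraph_def trace_hypergraph_def)
qed

text \<open>
  An automorphism \<open>\<phi>\<close> permutes the edges by some \<open>\<pi>\<close>, and a vertex with trace \<open>v\<close> goes to the vertex
  with trace \<open>\<pi> ` v\<close>. As vertices are determined by their traces, \<open>\<phi>\<close> is the identity once \<open>\<pi>\<close> is.
  Asymmetry thus becomes a rigidity property of the set system \<open>V\<close>.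
\<close>

lemma trace_hypergraph_asymmetric:
  assumes S: "finite S" "V \<subseteq> Pow S" and card: "\<And>i. i \<in> S \<Longrightarrow> card {v \<in> V. i \<in> v} = k"
    and inj: "inj_on (star V) S"
    and rigid: "\<And>\<pi> i. bij_betw \<pi> S S \<Longrightarrow> (\<And>v. v \<in> V \<Longrightarrow> \<pi> ` v \<in> V) \<Longrightarrow> i \<in> S \<Longrightarrow> \<pi> i = i"
  shows "asymmetric k (trace_hypergraph V S)"
  unfolding asymmetric_def
proof (intro allI impI ballI)
  fix \<phi> x
  assume aut: "automorphism k (trace_hypergraph V S) \<phi>"
    and x: "x \<in> verts (trace_hypergraph V S)"
  let ?X = "set_encode ` V"
  have bij: "bij_betw \<phi> ?X ?X"
    using aut by (simp add: automorphism_def isomorphism_def trace_hypergraph_def)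
  have edges_iff: "\<forall>A \<in> nsets ?X k. A \<in> star V ` S \<longleftrightarrow> \<phi> ` A \<in> star V ` S"
    using aut by (simp add: automorphism_def isomorphism_def trace_hypergraph_def)
  have star_sub: "star V i \<subseteq> ?X" for i by (auto simp: star_def)
  have "\<exists>j\<in>S. \<phi> ` star V i = star V j" if "i \<in> S" for i
  proof -
    have "star V i \<in> nsets ?X k"
      using trace_hypergraph_kgraph[OF S card] that
      by (auto simp: kgraph_def trace_hypergraph_def)
    then have "\<phi> ` star V i \<in> star V ` S"
      using edges_iff that by blast
    then show ?thesis by blast
  qed
  then obtain \<pi> where \<pi>: "\<And>i. i \<in> S \<Longrightarrow> \<pi> i \<in> S \<and> \<phi> ` star V i = star V (\<pi> i)"
    by metis
  have "inj_on \<pi> S"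
  proof (rule inj_onI)
    fix i j assume "i \<in> S" "j \<in> S" "\<pi> i = \<pi> j"
    then have "\<phi> ` star V i = \<phi> ` star V j" using \<pi> by metis
    then have "star V i = star V j"
      using bij star_sub by (meson bij_betw_imp_inj_on inj_on_image_eq_iff)
    then show "i = j" using inj \<open>i \<in> S\<close> \<open>j \<in> S\<close> by (meson inj_onD)
  qed
  then have bij\<pi>: "bij_betw \<pi> S S"
    using \<pi> S(1) by (metis bij_betw_def endo_inj_surj image_subsetI)
  have \<phi>_enc: "\<phi> (set_encode v) = set_encode (\<pi> ` v) \<and> \<pi> ` v \<in> V" if v: "v \<in> V" for v
  proof -
    obtain w where w: "w \<in> V" "\<phi> (set_encode v) = set_encode w"
      using bij v unfolding bij_betw_def by blast
    have iff: "i \<in> v \<longleftrightarrow> \<pi> i \<in> w" if i: "i \<in> S" for i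
    proof -
      have "i \<in> v \<longleftrightarrow> set_encode v \<in> star V i"
        using set_encode_mem_star_iff S v by simp
      also have "\<dots> \<longleftrightarrow> \<phi> (set_encode v) \<in> \<phi> ` star V i"
        using bij star_sub v by (meson bij_betw_imp_inj_on imageI inj_on_image_mem_iff)
      also have "\<dots> \<longleftrightarrow> \<pi> i \<in> w"
        using \<pi>[OF i] w set_encode_mem_star_iff S by simp
      finally show ?thesis .
    qed
    have "\<pi> ` v = w"
    proof
      show "\<pi> ` v \<subseteq> w" using iff v S(2) by blast
      show "w \<subseteq> \<pi> ` v"
      proof
        fix j assume "j \<in> w"
        then have "j \<in> \<pi> ` S" using bij\<pi> w(1) S(2) by (auto simp: bij_betw_def)
        then show "j \<in> \<pi> ` v" using iff \<open>j \<in> w\<close> by blast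
      qed
    qed
    then show ?thesis using w by simp
  qed
  obtain v where v: "v \<in> V" "x = set_encode v"
    using x by (auto simp: trace_hypergraph_def)
  have "\<pi> i = i" if "i \<in> S" for i
    using rigid[OF bij\<pi>] \<phi>_enc that by blast
  then have "\<pi> ` v = v" using v(1) S(2) by (force simp: image_iff)
  then show "\<phi> x = x" using \<phi>_enc v by simp
qed

text \<open>
  In a subgraph only the part of a trace on the surviving edges matters. The common surviving edge
  \<open>i\<close> guarantees that both vertices belong to the subgraph.
\<close>

lemma trace_twins_imp_symmetric:
  assumes S: "finite S" "V \<subseteq> Pow S" and H: "ksubgraph k H (trace_hypergraph V S)"
    and vw: "v \<in> V" "w \<in> V" "v \<noteq> w"
    and i: "i \<in> v" "i \<in> w" "star V i \<in> edges H"
    and traces: "\<And>j. star V j \<in> edges H \<Longrightarrow> j \<in> v \<longleftrightarrow> j \<in> w"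
  shows "symmetric k H"
proof (rule twins_imp_symmetric)
  have "star V i \<subseteq> verts H"
    using i(3) H by (auto simp: ksubgraph_def kgraph_def nsets_def)
  then show "set_encode v \<in> verts H" "set_encode w \<in> verts H"
    using set_encode_mem_star_iff[OF S] vw i by auto
  show "set_encode v \<noteq> set_encode w"
    using inj_on_set_encode_Pow[OF S] vw by (meson inj_onD)
  fix e assume e: "e \<in> edges H"
  then obtain j where "e = star V j"
    using H by (auto simp: ksubgraph_def trace_hypergraph_def)
  then show "set_encode v \<in> e \<longleftrightarrow> set_encode w \<in> e"
    using set_encode_mem_star_iff[OF S] vw traces e by simp
qed

section \<open>The trace family of a path with three special edges\<close>

text \<open>
  Among the non-special indices, \<open>i\<close> is missing from hub number \<open>min (i - 1) (k - 3)\<close> only: the edges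
  \<open>1, 2, \<dots>\<close> omit one hub each in turn, and all remaining ones omit the last hub. For \<open>p \<ge> k\<close> every
  hub is omitted somewhere before \<open>p\<close>.
\<close>

definition hub :: "nat \<Rightarrow> nat \<Rightarrow> nat \<Rightarrow> nat set" where
  "hub k p j = {i. i \<le> 3 * p \<and> (i \<in> {0, p, 3 * p} \<or> min (i - 1) (k - 3) \<noteq> j)}"

text \<open>
  The pairs are the links of the path and the singletons the private vertices; the two ends of the
  path count as private vertices of the first and the last edge.
\<close>

definition path_traces :: "nat \<Rightarrow> nat \<Rightarrow> nat set set" where
  "path_traces k p = {{i, Suc i} |i. i < 3 * p} \<union> {{i} |i. i \<le> 3 * p \<and> i \<noteq> p}
     \<union> hub k p ` {..<k - 2}"

lemma path_traces_subset: "path_traces k p \<subseteq> Pow {..3 * p}"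
  by (auto simp: path_traces_def hub_def)

lemma card_hub:
  assumes "p \<ge> 1"
  shows "card (hub k p j) \<ge> 3"
proof -
  have "card {0, p, 3 * p} \<le> card (hub k p j)"
    by (rule card_mono) (auto simp: hub_def)
  then show ?thesis using assms by simp
qed

lemma inj_on_hub:
  assumes "k \<ge> 3" "p \<ge> k"
  shows "inj_on (hub k p) {..<k - 2}"
proof (rule inj_onI)
  fix j j' assume j: "j \<in> {..<k - 2}" and eq: "hub k p j = hub k p j'"
  have "Suc j \<notin> hub k p j" using j assms by (auto simp: hub_def)
  then have "Suc j \<notin> hub k p j'" using eq by simp
  then show "j = j'" using j assms by (auto simp: hub_def)
qed

lemma path_traces_card_2:
  assumes "v \<in> path_traces k p" "card v = 2" "p \<ge> 1"
  obtains i where "i < 3 * p" "v = {i, Suc i}"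
proof -
  have "v \<noteq> hub k p j" for j using assms(2) card_hub[OF assms(3), of k j] by auto
  moreover have "v \<noteq> {i}" for i using assms(2) by auto
  ultimately show ?thesis using assms(1) that by (auto simp: path_traces_def)
qed

lemma singleton_mem_path_traces_iff:
  assumes "p \<ge> 1"
  shows "{i} \<in> path_traces k p \<longleftrightarrow> i \<le> 3 * p \<and> i \<noteq> p"
proof -
  have "{i} \<noteq> hub k p j" for j
    using card_hub[OF assms, of k j] by (auto dest: arg_cong[where f = card])
  then show ?thesis by (auto simp: path_traces_def)
qed

text \<open>
  Of two different edges at least one has a private vertex, which tells them apart.
\<close>

lemma inj_on_star_path_traces:
  assumes "p \<ge> 1"
  shows "inj_on (star (path_traces k p)) {..3 * p}"
proof -
  have neq: "star (path_traces k p) i \<noteq> star (path_traces k p) j"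
    if "i \<le> 3 * p" "i \<noteq> p" "i \<noteq> j" for i j
    using set_encode_mem_star_iff[OF finite_atMost path_traces_subset[of k p], of "{i}"]
      singleton_mem_path_traces_iff[OF assms, of i k] that by (metis singletonD singletonI)
  show ?thesis by (rule inj_onI) (metis atMost_iff neq)
qed

text \<open>
  A special edge has two local vertices (two links, or one link and a private vertex) and all \<open>k - 2\<close>
  hubs; any other edge has two links, a private vertex and \<open>k - 3\<close> hubs.
\<close>

lemma card_path_traces_star:
  assumes k: "k \<ge> 3" and p: "p \<ge> k" and i: "i \<le> 3 * p"
  shows "card {v \<in> path_traces k p. i \<in> v} = k"
proof -
  let ?special = "i \<in> {0, p, 3 * p}"
  define Q where "Q = {{j, Suc j} |j. j < 3 * p} \<union> {{j} |j. j \<le> 3 * p \<and> j \<noteq> p}"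
  define L where "L = {v \<in> Q. i \<in> v}"
  define R where "R = hub k p ` {j \<in> {..<k - 2}. i \<in> hub k p j}"
  have split: "{v \<in> path_traces k p. i \<in> v} = L \<union> R"
    by (auto simp: path_traces_def L_def R_def Q_def)
  have "card R = card {j \<in> {..<k - 2}. i \<in> hub k p j}"
    unfolding R_def by (rule card_image) (rule inj_on_subset[OF inj_on_hub[OF k p]], auto)
  also have "{j \<in> {..<k - 2}. i \<in> hub k p j}
      = (if ?special then {..<k - 2} else {..<k - 2} - {min (i - 1) (k - 3)})"
    using i by (auto simp: hub_def)
  also have "card \<dots> = (if ?special then k - 2 else k - 3)"
    using k by auto
  finally have cR: "card R = (if ?special then k - 2 else k - 3)" .
  have cL: "card L = (if ?special then 2 else 3)" and finL: "finite L"
  proof -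
    have pairs: "(\<exists>j<3 * p. v = {j, Suc j} \<and> i \<in> v) \<longleftrightarrow>
        i < 3 * p \<and> v = {i, Suc i} \<or> 0 < i \<and> v = {i - 1, i}" for v
    proof
      assume "\<exists>j<3 * p. v = {j, Suc j} \<and> i \<in> v"
      then obtain j where j: "j < 3 * p" "v = {j, Suc j}" "i = j \<or> i = Suc j" by blast
      then show "i < 3 * p \<and> v = {i, Suc i} \<or> 0 < i \<and> v = {i - 1, i}"
        by (elim disjE) simp_all
    next
      assume "i < 3 * p \<and> v = {i, Suc i} \<or> 0 < i \<and> v = {i - 1, i}"
      then show "\<exists>j<3 * p. v = {j, Suc j} \<and> i \<in> v"
      proof (elim disjE conjE)
        assume "0 < i" "v = {i - 1, i}"
        then show ?thesis using i by (intro exI[of _ "i - 1"]) simp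
      qed blast
    qed
    have mem: "v \<in> L \<longleftrightarrow> (\<exists>j<3 * p. v = {j, Suc j} \<and> i \<in> v) \<or> i \<noteq> p \<and> v = {i}" for v
      using i by (auto simp: L_def Q_def)
    have L: "L = (if i < 3 * p then {{i, Suc i}} else {})
        \<union> (if 0 < i then {{i - 1, i}} else {}) \<union> (if i \<noteq> p then {{i}} else {})"
      by (rule set_eqI) (simp add: mem pairs)
    consider "i = 0" | "i = p" | "i = 3 * p" | "\<not> ?special" by blast
    then have "card L = (if ?special then 2 else 3) \<and> finite L"
      using i k p by cases (auto simp: L doubleton_eq_iff card_insert_if)
    then show "card L = (if ?special then 2 else 3)" "finite L" by auto
  qed
  have "L \<inter> R = {}"
  proof -
    have "card v \<le> 2" if "v \<in> L" for v
      using that by (auto simp: L_def Q_def)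
    moreover have "card v \<ge> 3" if "v \<in> R" for v
      using that card_hub k p by (auto simp: R_def)
    ultimately show ?thesis by fastforce
  qed
  moreover have "finite R" by (simp add: R_def)
  ultimately have "card (L \<union> R) = card L + card R"
    using finL by (simp add: card_Un_disjoint)
  also have "\<dots> = k"
    unfolding cL cR using k by (cases ?special) simp_all
  finally show ?thesis unfolding split .
qed

text \<open>
  Injectivity forbids turning back, so all steps go in the same direction.
\<close>

lemma injective_unit_steps:
  fixes f :: "nat \<Rightarrow> int"
  assumes inj: "inj_on f {..n}"
    and step: "\<And>i. i < n \<Longrightarrow> \<bar>f (Suc i) - f i\<bar> = 1"
  obtains d where "\<bar>d\<bar> = 1" "\<And>i. i \<le> n \<Longrightarrow> f i = f 0 + d * int i"
proof (cases "n = 0")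
  case True
  then show ?thesis using that[of 1] by simp
next
  case False
  define d where "d = f 1 - f 0"
  have "Suc i \<le> n \<Longrightarrow> f (Suc i) - f i = d" for i
  proof (induction i)
    case (Suc i)
    have "f (Suc (Suc i)) \<noteq> f i" using inj Suc.prems by (auto dest: inj_onD)
    then show ?case using Suc step[of "Suc i"] step[of i] by auto
  qed (simp add: d_def)
  then have "i \<le> n \<Longrightarrow> f i = f 0 + d * int i" for i
    by (induction i) (auto simp: algebra_simps dest: Suc_leD)
  moreover have "\<bar>d\<bar> = 1" using step[of 0] False by (simp add: d_def)
  ultimately show ?thesis using that by blast
qed

text \<open>
  Being the traces of size two, the links are permuted by \<open>\<pi>\<close>, so \<open>\<pi>\<close> moves along the path in unit
  steps and is the identity or the reversal. The reversal would carry the trace \<open>{2 * p}\<close> to \<open>{p}\<close>,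
  which is not a trace.
\<close>

lemma path_traces_rigid:
  assumes p: "p \<ge> 1" and bij: "bij_betw \<pi> {..3 * p} {..3 * p}"
    and V: "\<And>v. v \<in> path_traces k p \<Longrightarrow> \<pi> ` v \<in> path_traces k p"
    and i: "i \<in> {..3 * p}"
  shows "\<pi> i = i"
proof -
  let ?n = "3 * p"
  have inj: "inj_on \<pi> {..?n}" and le: "\<And>j. j \<le> ?n \<Longrightarrow> \<pi> j \<le> ?n"
    using bij by (auto simp: bij_betw_def)
  have step: "\<bar>int (\<pi> (Suc j)) - int (\<pi> j)\<bar> = 1" if "j < ?n" for j
  proof -
    have "{j, Suc j} \<in> path_traces k p"
      using that unfolding path_traces_def by blast
    then have "\<pi> ` {j, Suc j} \<in> path_traces k p" by (rule V)
    moreover have "\<pi> j \<noteq> \<pi> (Suc j)"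
      using inj_onD[OF inj, of j "Suc j"] that by auto
    then have "card (\<pi> ` {j, Suc j}) = 2" by simp
    ultimately obtain l where "\<pi> ` {j, Suc j} = {l, Suc l}"
      by (rule path_traces_card_2[OF _ _ p])
    then show ?thesis by (auto simp: doubleton_eq_iff)
  qed
  have "inj_on (\<lambda>j. int (\<pi> j)) {..?n}" using inj by (auto simp: inj_on_def)
  then obtain d where d: "\<bar>d\<bar> = 1" "\<And>j. j \<le> ?n \<Longrightarrow> int (\<pi> j) = int (\<pi> 0) + d * int j"
    using injective_unit_steps[of "\<lambda>j. int (\<pi> j)" ?n] step by blast
  consider "d = 1" | "d = -1" using d(1) by linarith
  then show ?thesis
  proof cases
    case 1
    then show ?thesis using d(2)[of ?n] d(2)[of i] le[of ?n] i by simp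
  next
    case 2
    then have "\<pi> (2 * p) = p"
      using d(2)[of ?n] d(2)[of "2 * p"] le[of 0] by simp
    then have "{p} \<in> path_traces k p"
      using V[of "{2 * p}"] singleton_mem_path_traces_iff[OF p] p by auto
    then show ?thesis using singleton_mem_path_traces_iff[OF p] by blast
  qed
qed

section \<open>Asymmetric subgraphs are large\<close>

lemma neighbour_closed_interval:
  fixes a b i :: nat
  assumes closed: "\<And>j. a < j \<Longrightarrow> j < b \<Longrightarrow> j \<in> J \<Longrightarrow> j - 1 \<in> J \<and> Suc j \<in> J"
    and i: "i \<in> {a<..<b}" "i \<in> J"
  shows "{a<..<b} \<subseteq> J"
proof
  fix j assume j: "j \<in> {a<..<b}"
  show "j \<in> J"
  proof (cases "i \<le> j")
    case True
    then show ?thesis using j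
      by (induction j rule: dec_induct) (use i closed in auto)
  next
    case False
    then have "j \<le> i" by simp
    then show ?thesis using j
    proof (induction j rule: inc_induct)
      case (step l)
      then show ?case using closed[of "Suc l"] i by auto
    qed (use i in simp)
  qed
qed

text \<open>
  The surviving indices \<open>J\<close> spread from any non-special one in both directions until they meet a
  special index, because otherwise the private vertex of the last edge has a link as its twin. If
  only special indices survived, the two local vertices of one of them would be twins. The private
  vertices of the edges reached in this way are the vertices counted.
\<close>

lemma path_traces_asymmetric_subgraph_large:
  assumes k: "k \<ge> 3" and p: "p \<ge> k"
    and H: "ksubgraph k H (trace_hypergraph (path_traces k p) {..3 * p})"
    and asym: "asymmetric k H" and two: "card (verts H) \<ge> 2"
  shows "card (verts H) \<ge> p - 1"
proof -
  let ?V = "path_traces k p" and ?n = "3 * p"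
  define J where "J = {i. star ?V i \<in> edges H \<and> i \<le> ?n}"
  note S = finite_atMost[of ?n] path_traces_subset[of k p]
  have p1: "p \<ge> 1" using k p by simp
  have single: "{i} \<in> ?V" if "i \<le> ?n" "i \<noteq> p" for i
    using that singleton_mem_path_traces_iff[OF p1] by blast
  have pair: "{i, Suc i} \<in> ?V" if "i < ?n" for i
    using that by (auto simp: path_traces_def)
  have distinguished: "\<exists>j\<in>J. (j \<in> v) \<noteq> (j \<in> w)"
    if "v \<in> ?V" "w \<in> ?V" "v \<noteq> w" "i \<in> v" "i \<in> w" "i \<in> J" for v w i
  proof (rule ccontr)
    assume neg: "\<not> ?thesis"
    have "j \<in> v \<longleftrightarrow> j \<in> w" if "star ?V j \<in> edges H" for j
      using neg that \<open>v \<in> ?V\<close> \<open>w \<in> ?V\<close> S(2) unfolding J_def by blast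
    then show False
      using trace_twins_imp_symmetric[OF S H that(1-5)] that(6) asym by (auto simp: J_def)
  qed
  have closed: "i - 1 \<in> J \<and> Suc i \<in> J" if "i \<in> J" "0 < i" "i < ?n" "i \<noteq> p" for i
  proof
    have "\<exists>j\<in>J. (j \<in> {i}) \<noteq> (j \<in> {i - 1, Suc (i - 1)})"
      by (rule distinguished[where i = i]) (use that single pair[of "i - 1"] in auto)
    then show "i - 1 \<in> J" using that by auto
    have "\<exists>j\<in>J. (j \<in> {i}) \<noteq> (j \<in> {i, Suc i})"
      by (rule distinguished[where i = i]) (use that single pair in auto)
    then show "Suc i \<in> J" using that by auto
  qed
  obtain s where s: "s \<in> J"
    using edgeless_imp_symmetric[OF _ two] asym H
    by (force simp: J_def ksubgraph_def trace_hypergraph_def)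
  have "\<exists>i\<in>J. 0 < i \<and> i < ?n \<and> i \<noteq> p"
  proof (cases "s \<in> {0, p, ?n}")
    case True
    then consider "s = 0" | "s = p" | "s = ?n" by blast
    then show ?thesis
    proof cases
      case 1
      have "\<exists>j\<in>J. (j \<in> {0}) \<noteq> (j \<in> {0, Suc 0})"
        by (rule distinguished[where i = 0]) (use 1 s p1 single pair in auto)
      then show ?thesis using k p by force
    next
      case 2
      have "\<exists>j\<in>J. (j \<in> {p - 1, Suc (p - 1)}) \<noteq> (j \<in> {p, Suc p})"
        by (rule distinguished[where i = p])
          (use 2 s p1 pair[of p] pair[of "p - 1"] in \<open>auto simp: doubleton_eq_iff\<close>)
      then obtain j where "j \<in> J" "j = p - 1 \<or> j = Suc p" by auto
      moreover from this have "0 < j \<and> j < ?n \<and> j \<noteq> p" using k p by auto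
      ultimately show ?thesis by blast
    next
      case 3
      have "\<exists>j\<in>J. (j \<in> {?n}) \<noteq> (j \<in> {?n - 1, Suc (?n - 1)})"
        by (rule distinguished[where i = ?n])
          (use 3 s p1 single[of ?n] pair[of "?n - 1"] in auto)
      then show ?thesis using k p by force
    qed
  next
    case False
    then show ?thesis using s by (auto simp: J_def)
  qed
  then obtain i where i: "i \<in> J" "0 < i" "i < ?n" "i \<noteq> p" by blast
  (* a is 0 or p; of the longer gap after p only the first p - 1 indices are used,
     so that both cases have the same shape *)
  obtain a where a: "{a<..<a + p} \<subseteq> J" "p \<notin> {a<..<a + p}"
  proof (cases "i < p")
    case True
    then have "{0<..<p} \<subseteq> J"
      by (intro neighbour_closed_interval[of _ _ _ i]) (use closed i in auto)
    then show ?thesis using that[of 0] by simp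
  next
    case False
    then have "{p<..<?n} \<subseteq> J"
      by (intro neighbour_closed_interval[of _ _ _ i]) (use closed i in auto)
    moreover have "{p<..<p + p} \<subseteq> {p<..<?n}" by auto
    ultimately show ?thesis using that[of p] by auto
  qed
  have "set_encode {j} \<in> verts H" if j: "j \<in> {a<..<a + p}" for j
  proof -
    have "j \<in> J" "j \<noteq> p" using a j by auto
    then have "{j} \<in> ?V" using single by (simp add: J_def)
    then have "set_encode {j} \<in> star ?V j" unfolding star_def by blast
    moreover have "star ?V j \<subseteq> verts H"
      using \<open>j \<in> J\<close> H by (auto simp: J_def ksubgraph_def kgraph_def nsets_def)
    ultimately show ?thesis by blast
  qed
  moreover have "inj_on (\<lambda>j. set_encode {j}) {a<..<a + p}"
    by (simp add: inj_on_def)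
  moreover have "finite (verts H)" using H by (simp add: ksubgraph_def kgraph_def)
  ultimately have "card {a<..<a + p} \<le> card (verts H)"
    by (intro card_inj_on_le) auto
  then show ?thesis by simp
qed

lemma strongly_minimal_asymmetric_unbounded:
  assumes k: "k \<ge> 3"
  shows "\<exists>G :: nat hgraph. strongly_minimal_asymmetric k G \<and> card (verts G) > N"
proof -
  (* p - 1 > N makes asymmetric subgraphs large, p \<ge> k leaves room for all hubs *)
  define p where "p = N + k + 2"
  have p: "p \<ge> k" "p \<ge> 1" by (auto simp: p_def)
  let ?V = "path_traces k p"
  let ?G = "trace_hypergraph ?V {..3 * p}"
  note S = finite_atMost path_traces_subset
  have kg: "kgraph k ?G"
    by (rule trace_hypergraph_kgraph[OF S]) (simp add: card_path_traces_star[OF k p(1)])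
  have asym: "asymmetric k ?G"
  proof (rule trace_hypergraph_asymmetric[OF S _ inj_on_star_path_traces[OF p(2)]])
    show "card {v \<in> ?V. i \<in> v} = k" if "i \<in> {..3 * p}" for i
      using card_path_traces_star[OF k p(1)] that by simp
    show "\<pi> i = i" if "bij_betw \<pi> {..3 * p} {..3 * p}" "\<And>v. v \<in> ?V \<Longrightarrow> \<pi> ` v \<in> ?V"
      "i \<in> {..3 * p}" for \<pi> i
      using path_traces_rigid[OF p(2) that] .
  qed
  have "card (verts ?G) \<ge> 2"
  proof -
    have "star ?V 0 \<in> nsets (verts ?G) k"
      using kg by (auto simp: kgraph_def trace_hypergraph_def)
    then have "k \<le> card (verts ?G)"
      using kg card_mono[of "verts ?G" "star ?V 0"] by (auto simp: nsets_def kgraph_def)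
    then show ?thesis using k by simp
  qed
  then obtain H where H: "ksubgraph k H ?G" "card (verts H) \<ge> 2" "strongly_minimal_asymmetric k H"
    using strongly_minimal_asymmetric_ksubgraph_exists[OF kg asym] by blast
  then have "card (verts H) \<ge> p - 1"
    using path_traces_asymmetric_subgraph_large[OF k p(1)]
    by (simp add: strongly_minimal_asymmetric_def)
  then show ?thesis using H k by (intro exI[of _ H]) (simp add: p_def)
qed

theorem theorem4:
  fixes k :: nat
  assumes "k \<ge> 3"
  shows "\<exists>\<G> :: nat hgraph set.
           infinite \<G> \<and>
           pairwise (\<lambda>G H. \<not> isomorphic k G H) \<G> \<and>
           (\<forall>G \<in> \<G>. kgraph k G \<and> asymmetric k G \<and>
              (\<forall>H. proper_ksubgraph k H G \<and> card (verts H) \<ge> 2 \<longrightarrow> symmetric k H))"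
  using infinite_family_of_unbounded_order[OF strongly_minimal_asymmetric_unbounded[OF assms]]
  unfolding strongly_minimal_asymmetric_def .

end
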